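(* Let $f_1,\dots,f_n:2^V\to\mathbb{R}_{\ge 0}$ be monotone nondecreasing submodular functions with $f_i(\emptyset)=0$ for all $i$, let $f=\frac1n\sum_{i=1}^n f_i$, let $K$ be an integer with $1\le K\le |V|$, let $\mathcal{G}=(\mathcal{N},\mathcal{E})$ be a connected undirected graph on $\mathcal{N}=\{1,\dots,n\}$, and let $W\in\mathbb{R}^{n\times n}$ be an admissible weight matrix for $\mathcal{G}$. Let $T\in\mathbb{Z}_{\ge 1}$, $T'=T+1+d(\mathcal{G})$, let $F_h=\max_{i\in\mathcal{N}}f_i(V)$, $\epsilon(T)=\sqrt{n}\,(\mu(W))^T F_h$, and let $\psi\in\mathbb{R}_{\ge 0}$ satisfy $\psi\ge 4\sqrt{n}\,(\mu(W))^T F_h$. Then the Distributed Greedy Algorithm (described in the context), run with these data, lets all agents in $\mathcal{N}$ reach consensus at a solution $\bar S^K$ to the problem $\max_{S\subseteq V,\ |S|\le K} f(S)$, i.e. $\bar S_i^K=\bar S_j^K=:\bar S^K$ for all $i,j\in\mathcal{N}$, with $|\bar S^K|\le K$, that satisfies $$f(\bar S^K)\ \ge\ \Big(1-\frac1e\Big) f(S^* )-K\big(\psi+2\epsilon(T)\big),$$ where $S^*$ is an optimal solution to $\max_{S\subseteq V,\ |S|\le K} f(S)$.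
   Context: Setting. $V=\{v_1,\dots,v_{|V|}\}$ is a finite ground set whose labelling is common to all agents. A set function $g:2^V\to\mathbb{R}_{\ge0}$ is monotone nondecreasing if $g(A)\le g(B)$ for all $A\subseteq B\subseteq V$, and submodular if $g(\{v\}\cup A)-g(A)\ge g(\{v\}\cup B)-g(B)$ for all $A\subseteq B\subseteq V$ and $v\in V\setminus B$. There are $n\ge2$ agents $\mathcal{N}=\{1,\dots,n\}$; $\mathcal{N}_i=\{j\in\mathcal{N}:(i,j)\in\mathcal{E}\}$ is the set of neighbours of $i$; $d(\mathcal{G})=\max_{i,j\in\mathcal{N}}l_{ij}$ is the diameter of $\mathcal{G}$, where $l_{ij}$ is the length of a shortest path from $i$ to $j$. Admissible weight matrix. $W=(w_{ij})\in\mathbb{R}^{n\times n}$ is admissible for $\mathcal{G}$ if: (1) $w_{ij}\ge0$ for all $i,j$, and $w_{ij}=0$ whenever $i\ne j$ and $(i,j)\notin\mathcal{E}$; (2) $W\mathbf{1}_n=\mathbf{1}_n$, where $\mathbf{1}_n$ is the all-ones vector; (3) $W$ is symmetric; (4) $\mu(W):=\max\{\lambda_2(W),-\lambda_n(W)\}<1$, where $1=\lambda_1(W)\ge\lambda_2(W)\ge\cdots\ge\lambda_n(W)\ge-1$ are the eigenvalues of $W$. Distributed Greedy Algorithm. All agents share a synchronized clock and know $T$, $T'$, $\psi$ and $K$; agent $i$ knows $f_i$ and the $i$th row of $W$. Initially $\bar S_i^0=\emptyset$ for every agent $i$. For $k=0,1,\dots,K-1$ each agent $i$ performs the following round (the round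 starts with all agents holding the same set $\bar S_i^k$; that this is preserved from round to round is part of the consensus property claimed for the algorithm), with $V_k=V\setminus\bar S_i^k$: (i) set $x_{i,v}^0=f_i(\{v\}\cup\bar S_i^k)-f_i(\bar S_i^k)$ for $v\in V_k$; (ii) for $t=0,\dots,T-1$ and all $v\in V_k$, set $x_{i,v}^{t+1}=w_{ii}x_{i,v}^t+\sum_{j\in\mathcal{N}_i}w_{ij}x_{j,v}^t$; (iii) set $S_i^{T+1}=\{v\in V_k: x_{i,v}^T\ge \max_{u\in V_k}x_{i,u}^T-\psi\}$; (iv) for $t=T+1,\dots,T'-1$, set $S_i^{t+1}=\bigcap_{j\in\mathcal{N}_i}S_j^t$; (v) let $j_{\min}=\min\{j: v_j\in S_i^{T'}\}$ and set $\bar S_i^{k+1}=\{v_{j_{\min}}\}\cup\bar S_i^k$. The output of agent $i$ is $\bar S_i^K$.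
   Formalization: In step (iv) each agent intersects its own set together with its neighbours' sets (j ranges over {i} ∪ N_i, not N_i alone); as printed, with i not in N_i, two agents joined by one edge merely swap their sets and consensus can fail. *)

theory Defs
  imports
    Complex_Main
    "HOL-Library.Multiset"
    "Jordan_Normal_Form.Char_Poly"
    "Graph_Theory.Graph_Theory"
begin

definition monotone_setfun :: "'a set \<Rightarrow> ('a set \<Rightarrow> real) \<Rightarrow> bool" where
  "monotone_setfun V g \<longleftrightarrow> (\<forall>A B. A \<subseteq> B \<and> B \<subseteq> V \<longrightarrow> g A \<le> g B)"

definition submodular :: "'a set \<Rightarrow> ('a set \<Rightarrow> real) \<Rightarrow> bool" where
  "submodular V g \<longleftrightarrow>
     (\<forall>A B. \<forall>u \<in> V - B. A \<subseteq> B \<and> B \<subseteq> V \<longrightarrow>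
        g ({u} \<union> B) - g B \<le> g ({u} \<union> A) - g A)"

text \<open>Undirected graphs are symmetric loop-free digraphs (locale \<^locale>\<open>pair_graph\<close>).
  The vertices are the agents \<open>0, \<dots>, n - 1\<close>, so that they directly index
  rows and columns of matrices.\<close>

definition nbrs :: "nat pair_pre_digraph \<Rightarrow> nat \<Rightarrow> nat set" where
  "nbrs G i = {j \<in> pverts G. (i, j) \<in> parcs G}"

definition path_dist :: "nat pair_pre_digraph \<Rightarrow> nat \<Rightarrow> nat \<Rightarrow> nat" where
  "path_dist G i j = (LEAST l. \<exists>p. pre_digraph.apath (with_proj G) i p j \<and> length p = l)"

definition diam :: "nat pair_pre_digraph \<Rightarrow> nat" where
  "diam G = Max {path_dist G i j | i j. i \<in> pverts G \<and> j \<in> pverts G}"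

text \<open>The real eigenvalues, with algebraic multiplicity, in nonincreasing order. A real
  symmetric matrix of dimension \<open>n\<close> has exactly \<open>n\<close> of them. \<open>eig k W\<close> is
  the \<open>k\<close>-th largest one, counting from \<open>1\<close>.\<close>

definition eigs :: "real mat \<Rightarrow> real list" where
  "eigs W = rev (sorted_list_of_multiset (proots (char_poly W)))"

definition eig :: "nat \<Rightarrow> real mat \<Rightarrow> real" where
  "eig k W = eigs W ! (k - 1)"

definition mu :: "real mat \<Rightarrow> real" where
  "mu W = max (eig 2 W) (- eig (dim_row W) W)"

definition admissible :: "nat \<Rightarrow> nat pair_pre_digraph \<Rightarrow> real mat \<Rightarrow> bool" where
  "admissible n G W \<longleftrightarrow>
     W \<in> carrier_mat n n \<and>
     (\<forall>i<n. \<forall>j<n. 0 \<le> W $$ (i, j)) \<and>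
     (\<forall>i<n. \<forall>j<n. i \<noteq> j \<and> (i, j) \<notin> parcs G \<longrightarrow> W $$ (i, j) = 0) \<and>
     W *\<^sub>v vec n (\<lambda>_. 1) = vec n (\<lambda>_. 1) \<and>
     transpose_mat W = W \<and>
     mu W < 1"

text \<open>Within one round, \<open>Sb j\<close> is the set held by agent \<open>j\<close> at the start of the round.\<close>

primrec consensus_val ::
  "(nat \<Rightarrow> 'a set \<Rightarrow> real) \<Rightarrow> nat pair_pre_digraph \<Rightarrow> real mat \<Rightarrow> (nat \<Rightarrow> 'a set) \<Rightarrow>
   nat \<Rightarrow> nat \<Rightarrow> 'a \<Rightarrow> real" where
  "consensus_val f G W Sb 0 i u = f i ({u} \<union> Sb i) - f i (Sb i)"
| "consensus_val f G W Sb (Suc t) i u =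
     W $$ (i, i) * consensus_val f G W Sb t i u +
     (\<Sum>j\<in>nbrs G i. W $$ (i, j) * consensus_val f G W Sb t j u)"

definition initial_candidates ::
  "'a set \<Rightarrow> (nat \<Rightarrow> 'a set \<Rightarrow> real) \<Rightarrow> nat pair_pre_digraph \<Rightarrow> real mat \<Rightarrow> nat \<Rightarrow> real \<Rightarrow>
   (nat \<Rightarrow> 'a set) \<Rightarrow> nat \<Rightarrow> 'a set" where
  "initial_candidates V f G W T \<psi> Sb i =
     {u \<in> V - Sb i.
        consensus_val f G W Sb T i u \<ge> Max (consensus_val f G W Sb T i ` (V - Sb i)) - \<psi>}"

text \<open>\<open>candidates G C s i\<close> is the candidate set of agent \<open>i\<close> after \<open>s\<close> exchanges,
  starting from the sets \<open>C\<close>. In an exchange an agent intersects its own candidate set with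
  those of its neighbours. The own set has to take part: \<open>i \<notin> nbrs G i\<close>, and with
  the intersection over \<open>nbrs G i\<close> alone two agents joined by a single edge would only swap
  their sets for ever.\<close>

primrec candidates ::
  "nat pair_pre_digraph \<Rightarrow> (nat \<Rightarrow> 'a set) \<Rightarrow> nat \<Rightarrow> nat \<Rightarrow> 'a set" where
  "candidates G C 0 i = C i"
| "candidates G C (Suc s) i = (\<Inter>j\<in>{i} \<union> nbrs G i. candidates G C s j)"

text \<open>The first candidate sets carry time index \<open>T + 1\<close> and the last ones \<open>T'\<close>, hence
  \<open>T' - (T + 1)\<close> exchanges.\<close>

definition final_candidates ::
  "'a set \<Rightarrow> (nat \<Rightarrow> 'a set \<Rightarrow> real) \<Rightarrow> nat pair_pre_digraph \<Rightarrow> real mat \<Rightarrow> nat \<Rightarrow> nat \<Rightarrow> real \<Rightarrow>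
   (nat \<Rightarrow> 'a set) \<Rightarrow> nat \<Rightarrow> 'a set" where
  "final_candidates V f G W T T' \<psi> Sb =
     candidates G (initial_candidates V f G W T \<psi> Sb) (T' - (T + 1))"

definition min_label :: "'a set \<Rightarrow> (nat \<Rightarrow> 'a) \<Rightarrow> 'a set \<Rightarrow> nat" where
  "min_label V v S = Min {j \<in> {1..card V}. v j \<in> S}"

primrec dist_greedy ::
  "'a set \<Rightarrow> (nat \<Rightarrow> 'a) \<Rightarrow> (nat \<Rightarrow> 'a set \<Rightarrow> real) \<Rightarrow> nat pair_pre_digraph \<Rightarrow> real mat \<Rightarrow>
   nat \<Rightarrow> nat \<Rightarrow> real \<Rightarrow> nat \<Rightarrow> nat \<Rightarrow> 'a set" where
  "dist_greedy V v f G W T T' \<psi> 0 i = {}"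
| "dist_greedy V v f G W T T' \<psi> (Suc k) i =
     {v (min_label V v (final_candidates V f G W T T' \<psi> (dist_greedy V v f G W T T' \<psi> k) i))}
       \<union> dist_greedy V v f G W T T' \<psi> k i"

end

theory Submission
  imports Defs "Jordan_Normal_Form.Schur_Decomposition"
begin

text \<open>
  Each round of the algorithm is an approximate step of the centralized greedy algorithm for the
  mean function \<open>f\<close>, and approximate greedy steps lose little.

  Suppose all agents hold the set \<open>S\<close>. For a fixed candidate \<open>w\<close>, the local marginal
  gains of the agents form a vector in \<open>[0, F\<^sub>h]\<^sup>n\<close> whose mean is the marginal gain of
  \<open>w\<close> under \<open>f\<close>. Averaging with \<open>W\<close> keeps that mean and shrinks the deviation
  from it by the factor \<open>mu W\<close> in Euclidean norm (\<open>contraction_orthogonal_to_ones\<close>); this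
  is the spectral theorem for \<open>W\<close>, where the condition \<open>mu W < 1\<close> makes the constant
  vectors the whole eigenspace of \<open>1\<close>. So after \<open>T\<close> steps every agent knows every marginal
  gain of \<open>f\<close> up to \<open>\<epsilon>\<close> (\<open>consensus_error\<close>).

  Because \<open>\<psi> \<ge> 2\<epsilon>\<close>, a true maximizer of the marginal gain survives in the candidate set of
  every agent, so the intersection of all candidate sets is nonempty; \<open>diam G\<close> exchanges give
  precisely this intersection to every agent (\<open>candidates_diam\<close>), and the common labelling makes
  all agents pick the same element of it. An element that passes the test of one agent is within
  \<open>\<psi> + 2\<epsilon>\<close> of the best marginal gain (\<open>distributed_round\<close>).

  Finally, by submodularity the gap to the optimum is at most \<open>K\<close> times the best marginal gain.
  A step that misses the best gain by at most \<open>\<delta>\<close> hence turns a gap \<open>x\<close> into at most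
  \<open>(1 - 1/K) x + \<delta>\<close>, and \<open>K\<close> steps leave
  \<open>(1 - 1/K)\<^sup>K \<le> 1/e\<close> of the initial gap plus \<open>K \<delta>\<close>
  (\<open>approximate_greedy\<close>).
\<close>

section \<open>Orthogonal diagonalization of real symmetric matrices\<close>

text \<open>For an eigenvector \<open>x\<close>, symmetry lets the matrix act on either factor of
  \<open>x \<bullet>c x\<close>, which multiplies this nonzero number by \<open>a\<close> or by its conjugate.\<close>

lemma real_symmetric_complex_eigenvalue_real:
  fixes A :: "real mat"
  assumes A: "A \<in> carrier_mat n n" and sym: "transpose_mat A = A"
    and ev: "eigenvalue (map_mat complex_of_real A) a"
  shows "complex_of_real (Re a) = a"
proof -
  let ?C = "map_mat complex_of_real A"
  have C: "?C \<in> carrier_mat n n" using A by simp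
  have symC: "transpose_mat ?C = ?C"
    using arg_cong[OF sym, of "map_mat complex_of_real"] by (simp add: map_mat_transpose)
  from ev obtain x where x: "x \<in> carrier_vec n" "x \<noteq> 0\<^sub>v n" and eq: "?C *\<^sub>v x = a \<cdot>\<^sub>v x"
    using A unfolding eigenvalue_def eigenvector_def by auto
  have cx: "conjugate x \<in> carrier_vec n" using x by simp
  have "?C *\<^sub>v conjugate x = conjugate (?C *\<^sub>v x)"
    using A x by (intro eq_vecI) (auto simp: scalar_prod_def)
  also have "\<dots> = cnj a \<cdot>\<^sub>v conjugate x"
    unfolding eq by (intro eq_vecI) auto
  finally have eq': "?C *\<^sub>v conjugate x = cnj a \<cdot>\<^sub>v conjugate x" .
  have "a * (x \<bullet>c x) = (?C *\<^sub>v x) \<bullet>c x"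
    unfolding eq using x cx by simp
  also have "\<dots> = x \<bullet> (?C *\<^sub>v conjugate x)"
    using transpose_vec_mult_scalar[OF C cx x(1)] symC by simp
  also have "\<dots> = cnj a * (x \<bullet>c x)"
    unfolding eq' using x cx by simp
  finally have "a = cnj a"
    using x conjugate_square_eq_0_vec[OF x(1)] by auto
  then show ?thesis
    by (metis Reals_cnj_iff of_real_Re)
qed

text \<open>The linear factors over the complex numbers are real, and the
  embedding of real into complex polynomials is injective.\<close>

lemma real_symmetric_char_poly_splits:
  fixes A :: "real mat"
  assumes A: "A \<in> carrier_mat n n" and sym: "transpose_mat A = A"
  shows "\<exists>es. char_poly A = (\<Prod>e\<leftarrow>es. [:- e, 1:]) \<and> length es = n"
proof -
  let ?C = "map_mat complex_of_real A"
  have C: "?C \<in> carrier_mat n n" using A by simp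
  interpret of_real_poly_hom: map_poly_inj_comm_ring_hom complex_of_real ..
  obtain as where as: "char_poly ?C = (\<Prod>a\<leftarrow>as. [:- a, 1:])" "length as = n"
    using char_poly_factorized[OF C] by blast
  have re: "complex_of_real (Re a) = a" if "a \<in> set as" for a
  proof (rule real_symmetric_complex_eigenvalue_real[OF A sym])
    have "poly (char_poly ?C) a = 0"
      unfolding as(1) poly_prod_list using that by (auto simp: prod_list_zero_iff)
    then show "eigenvalue ?C a" using eigenvalue_root_char_poly[OF C] by blast
  qed
  have "map_poly complex_of_real (char_poly A) = (\<Prod>a\<leftarrow>as. [:- a, 1:])"
    unfolding as(1)[symmetric] by (rule of_real_hom.char_poly_hom[OF A, symmetric])
  also have "\<dots> = (\<Prod>a\<leftarrow>as. map_poly complex_of_real [:- Re a, 1:])"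
    by (intro arg_cong[of _ _ prod_list] map_cong refl) (use re in \<open>simp add: hom_distribs\<close>)
  also have "\<dots> = map_poly complex_of_real (\<Prod>e\<leftarrow>map Re as. [:- e, 1:])"
    by (simp add: of_real_poly_hom.hom_prod_list o_def)
  finally have "char_poly A = (\<Prod>e\<leftarrow>map Re as. [:- e, 1:])"
    using of_real_poly_hom.injectivity by blast
  then show ?thesis using as(2) by (metis length_map)
qed

text \<open>Extend \<open>x\<close> to a basis, apply Gram-Schmidt and normalize.\<close>

lemma orthogonal_matrix_with_first_column:
  fixes x :: "real vec"
  assumes x: "x \<in> carrier_vec n" and x0: "x \<noteq> 0\<^sub>v n"
  shows "\<exists>U c. U \<in> carrier_mat n n \<and> transpose_mat U * U = 1\<^sub>m n \<and> col U 0 = c \<cdot>\<^sub>v x"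
proof -
  have n: "n > 0" using x x0 by (cases n) auto
  interpret cof_vec_space n "TYPE(real)" .
  define b where "b = basis_completion x"
  define ws where "ws = gram_schmidt n b"
  from basis_completion[OF x x0, folded b_def]
  have bc: "set b \<subseteq> carrier_vec n" "distinct b" "\<not> lin_dep (set b)" "hd b = x" "length b = n"
    by auto
  from bc n obtain vs where bv: "b = x # vs" by (cases b) auto
  from gram_schmidt_result[OF bc(1-3) refl, folded ws_def]
  have ws: "set ws \<subseteq> carrier_vec n" "corthogonal ws" "length ws = n"
    by (auto simp: bc)
  have "hd ws = x" unfolding ws_def bv using x by simp
  then have ws0: "ws ! 0 = x" using ws(3) n by (cases ws) auto
  have wsc: "ws ! i \<in> carrier_vec n" if "i < n" for i using ws that by auto
  have orth: "(ws ! i \<bullet> ws ! j = 0) = (i \<noteq> j)" if "i < n" "j < n" for i j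
    using corthogonalD[OF ws(2)] that ws(3) by simp
  define U where "U = mat n n (\<lambda>(i, j). (ws ! j) $ i / sqrt (ws ! j \<bullet> ws ! j))"
  have U: "U \<in> carrier_mat n n" unfolding U_def by simp
  have colU: "col U j = (1 / sqrt (ws ! j \<bullet> ws ! j)) \<cdot>\<^sub>v ws ! j" if "j < n" for j
    using that wsc[OF that] unfolding U_def by (intro eq_vecI) auto
  have "transpose_mat U * U = 1\<^sub>m n"
  proof (rule eq_matI)
    fix i j assume "i < dim_row (1\<^sub>m n)" "j < dim_col (1\<^sub>m n)"
    then have ij: "i < n" "j < n" by auto
    have pos: "ws ! i \<bullet> ws ! i > 0"
      using orth[OF ij(1) ij(1)] sum_nonneg[of "{0..<dim_vec (ws ! i)}" "\<lambda>k. ws ! i $ k * ws ! i $ k"]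
      by (simp add: scalar_prod_def)
    have "(transpose_mat U * U) $$ (i, j) = col U i \<bullet> col U j"
      using ij U by simp
    also have "\<dots> = (ws ! i \<bullet> ws ! j) / (sqrt (ws ! i \<bullet> ws ! i) * sqrt (ws ! j \<bullet> ws ! j))"
      unfolding colU[OF ij(1)] colU[OF ij(2)] using wsc[OF ij(1)] wsc[OF ij(2)] by simp
    also have "\<dots> = (if i = j then 1 else 0)"
      using orth[OF ij] pos by auto
    finally show "(transpose_mat U * U) $$ (i, j) = 1\<^sub>m n $$ (i, j)" using ij by simp
  qed (use U in auto)
  then show ?thesis using U colU[OF n] ws0 by auto
qed

text \<open>The spectral theorem, with the eigenvalues appearing on the diagonal in any order prescribed by
  a factorization of the characteristic polynomial. Conjugating with an orthogonal matrix whose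
  first column is an eigenvector for the first root clears the first column below the diagonal; conjugation
  with an orthogonal matrix keeps symmetry, so the first row is cleared as well, and induction
  applies to the remaining symmetric block.\<close>

lemma real_symmetric_diagonalization:
  fixes A :: "real mat"
  assumes "A \<in> carrier_mat n n" and "transpose_mat A = A"
    and "char_poly A = (\<Prod>e\<leftarrow>es. [:- e, 1:])"
  shows "\<exists>P. P \<in> carrier_mat n n \<and> transpose_mat P * P = 1\<^sub>m n \<and>
    transpose_mat P * A * P = mat n n (\<lambda>(i, j). if i = j then es ! i else 0)"
  using assms
proof (induction es arbitrary: n A)
  case Nil
  then have "n = 0" using degree_monic_char_poly[of A n] by simp
  then show ?case using Nil by (intro exI[of _ "1\<^sub>m 0"]) auto
next
  case (Cons e es n A)
  note A = Cons.prems(1) and sym = Cons.prems(2) and cp = Cons.prems(3)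
  have "eigenvalue A e"
    unfolding eigenvalue_root_char_poly[OF A] cp by simp
  then obtain x where x: "x \<in> carrier_vec n" "x \<noteq> 0\<^sub>v n" and eigen: "A *\<^sub>v x = e \<cdot>\<^sub>v x"
    using A unfolding eigenvalue_def eigenvector_def by auto
  have n: "n > 0" using x by (cases n) auto
  then obtain m where m: "n = Suc m" by (cases n) auto
  obtain U c where U: "U \<in> carrier_mat n n" and UU: "transpose_mat U * U = 1\<^sub>m n"
    and U0: "col U 0 = c \<cdot>\<^sub>v x"
    using orthogonal_matrix_with_first_column[OF x] by blast
  have tU: "transpose_mat U \<in> carrier_mat n n" using U by simp
  have UU': "U * transpose_mat U = 1\<^sub>m n"
    by (rule mat_mult_left_right_inverse[OF tU U UU])
  define M where "M = transpose_mat U * A * U"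
  have M: "M \<in> carrier_mat n n" unfolding M_def using U A by simp
  have symM: "transpose_mat M = M"
    unfolding M_def using U A tU sym
    by (simp add: transpose_mult[of _ n n _ n] assoc_mult_mat[of _ n n _ n _ n])
  have simM: "similar_mat M A" unfolding similar_mat_def
    using similar_mat_witI[OF UU UU' M_def M A tU U] by blast
  have col0: "M $$ (i, 0) = (if i = 0 then e else 0)" if i: "i < n" for i
  proof -
    have "col M 0 = transpose_mat U *\<^sub>v (A *\<^sub>v col U 0)"
      unfolding M_def assoc_mult_mat[OF tU A U]
      unfolding col_mult2[OF tU mult_carrier_mat[OF A U] n] col_mult2[OF A U n] ..
    also have "A *\<^sub>v col U 0 = e \<cdot>\<^sub>v col U 0"
      unfolding U0 using A x eigen by (simp add: mult_mat_vec smult_smult_assoc mult.commute)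
    also have "transpose_mat U *\<^sub>v (e \<cdot>\<^sub>v col U 0) = e \<cdot>\<^sub>v col (transpose_mat U * U) 0"
      unfolding col_mult2[OF tU U n] using U n by (intro mult_mat_vec[OF tU]) auto
    finally have "col M 0 $ i = (e \<cdot>\<^sub>v col (1\<^sub>m n) 0) $ i" unfolding UU by simp
    then show ?thesis using M n i by simp
  qed
  have row0: "M $$ (0, i) = (if i = 0 then e else 0)" if i: "i < n" for i
    using col0[OF i] arg_cong[OF symM, of "\<lambda>N. N $$ (i, 0)"] M i n by simp
  define N where "N = mat m m (\<lambda>(i, j). M $$ (Suc i, Suc j))"
  have N: "N \<in> carrier_mat m m" unfolding N_def by simp
  let ?E = "mat 1 1 (\<lambda>_. e)"
  have block: "M = four_block_mat ?E (0\<^sub>m 1 m) (0\<^sub>m m 1) N"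
    by (rule eq_matI) (use M m col0 row0 in \<open>auto simp: N_def\<close>)
  have symN: "transpose_mat N = N"
  proof (rule eq_matI)
    fix i j assume "i < dim_row N" "j < dim_col N"
    then have "i < m" "j < m" using N by auto
    then show "transpose_mat N $$ (i, j) = N $$ (i, j)"
      using arg_cong[OF symM, of "\<lambda>L. L $$ (Suc i, Suc j)"] M m by (simp add: N_def)
  qed (use N in auto)
  have "char_poly M = char_poly ?E * char_poly N"
    unfolding block by (rule char_poly_four_block_zeros_col[OF _ _ N]) auto
  also have "char_poly ?E = [: -e, 1 :]"
    by (simp add: char_poly_defs det_def sign_def)
  finally have "[: -e, 1 :] * char_poly N = [: -e, 1 :] * (\<Prod>e\<leftarrow>es. [:- e, 1:])"
    using cp char_poly_similar[OF simM] by simp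
  then have cpN: "char_poly N = (\<Prod>e\<leftarrow>es. [:- e, 1:])"
    by (metis mult_cancel_left pCons_eq_0_iff zero_neq_one)
  from Cons.IH[OF N symN cpN] obtain Q where Q: "Q \<in> carrier_mat m m"
    and QQ: "transpose_mat Q * Q = 1\<^sub>m m"
    and QNQ: "transpose_mat Q * N * Q = mat m m (\<lambda>(i, j). if i = j then es ! i else 0)"
    by blast
  define R where "R = four_block_mat (1\<^sub>m 1) (0\<^sub>m 1 m) (0\<^sub>m m 1) Q"
  have R: "R \<in> carrier_mat n n" unfolding R_def using Q m by auto
  have tR: "transpose_mat R \<in> carrier_mat n n" using R by simp
  have tR_block: "transpose_mat R = four_block_mat (1\<^sub>m 1) (0\<^sub>m 1 m) (0\<^sub>m m 1) (transpose_mat Q)"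
    unfolding R_def using Q by (subst transpose_four_block_mat[of _ 1 1 _ m _ m]) auto
  have "transpose_mat R * R = four_block_mat (1\<^sub>m 1) (0\<^sub>m 1 m) (0\<^sub>m m 1) (1\<^sub>m m)"
    unfolding tR_block unfolding R_def using Q QQ
    by (subst mult_four_block_mat[of _ 1 1 _ m _ m _ _ 1 _ m]) auto
  also have "\<dots> = 1\<^sub>m n"
    by (rule eq_matI) (auto simp: m)
  finally have RR: "transpose_mat R * R = 1\<^sub>m n" .
  have "transpose_mat R * M * R
      = four_block_mat ?E (0\<^sub>m 1 m) (0\<^sub>m m 1) (transpose_mat Q * N * Q)"
    unfolding tR_block unfolding R_def block using Q N
    by (simp add: mult_four_block_mat[of _ 1 1 _ m _ m _ _ 1 _ m])
  also have "\<dots> = mat n n (\<lambda>(i, j). if i = j then (e # es) ! i else 0)"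
    unfolding QNQ by (rule eq_matI) (auto simp: m nth_Cons')
  finally have RMR: "transpose_mat R * M * R
      = mat n n (\<lambda>(i, j). if i = j then (e # es) ! i else 0)" .
  have PP: "transpose_mat (U * R) * (U * R) = transpose_mat R * (transpose_mat U * U) * R"
    using U R tU tR
    by (simp add: transpose_mult[of _ n n _ n] assoc_mult_mat[of _ n n _ n _ n])
  have PAP: "transpose_mat (U * R) * A * (U * R) = transpose_mat R * M * R"
    unfolding M_def using U R tU tR A
    by (simp add: transpose_mult[of _ n n _ n] assoc_mult_mat[of _ n n _ n _ n])
  show ?case
    by (rule exI[of _ "U * R"]) (use PP PAP UU RR RMR U R tR in auto)
qed

text \<open>Links the sorted list of roots \<open>eigs\<close> to the list that
  \<open>real_symmetric_diagonalization\<close> expects.\<close>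

lemma eigs_real_symmetric:
  fixes A :: "real mat"
  assumes A: "A \<in> carrier_mat n n" and sym: "transpose_mat A = A"
  shows "char_poly A = (\<Prod>e\<leftarrow>eigs A. [:- e, 1:])" and "length (eigs A) = n"
proof -
  obtain es where es: "char_poly A = (\<Prod>e\<leftarrow>es. [:- e, 1:])" "length es = n"
    using real_symmetric_char_poly_splits[OF A sym] by blast
  have "(\<Prod>e\<leftarrow>es. [:- e, 1:]) \<noteq> 0" for es :: "real list"
    by (induction es) (auto simp del: mult_pCons_left)
  then have "proots (char_poly A) = mset es"
    unfolding es(1)
    by (induction es) (auto simp: proots_mult simp del: mult_pCons_left)
  then have ms: "mset (eigs A) = mset es"
    unfolding eigs_def by simp
  then show "length (eigs A) = n" using es(2) by (metis size_mset)
  have "(\<Prod>e\<leftarrow>eigs A. [:- e, 1:]) = prod_mset (image_mset (\<lambda>e. [:- e, 1:]) (mset (eigs A)))"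
    by (metis mset_map prod_mset_prod_list)
  also have "\<dots> = (\<Prod>e\<leftarrow>es. [:- e, 1:])"
    unfolding ms by (metis mset_map prod_mset_prod_list)
  finally show "char_poly A = (\<Prod>e\<leftarrow>eigs A. [:- e, 1:])" using es(1) by simp
qed

lemma eigs_decreasing:
  assumes "i \<le> j" "j < length (eigs A)"
  shows "eigs A ! j \<le> eigs A ! i"
proof -
  have "sorted (rev (eigs A))" unfolding eigs_def by (simp add: sorted_sorted_list_of_multiset)
  then show ?thesis using assms by (simp add: sorted_rev_nth_mono)
qed

text \<open>The sorted eigenvalues after the first lie between the last and the second one, and
  \<open>mu\<close> dominates the second one and the negative of the last one.\<close>

lemma abs_eigs_le_mu:
  fixes A :: "real mat"
  assumes A: "A \<in> carrier_mat n n" and sym: "transpose_mat A = A"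
    and k: "1 \<le> k" "k < n"
  shows "\<bar>eigs A ! k\<bar> \<le> mu A"
proof -
  have len: "length (eigs A) = n" by (rule eigs_real_symmetric[OF A sym])
  have "eigs A ! k \<le> eigs A ! 1" "eigs A ! (n - 1) \<le> eigs A ! k"
    using k len by (auto intro!: eigs_decreasing)
  then show ?thesis using A by (simp add: mu_def eig_def)
qed

text \<open>In orthonormal eigencoordinates \<open>W\<close> multiplies the coordinate \<open>k\<close> by the
  \<open>k\<close>-th eigenvalue, which for \<open>k \<ge> 1\<close> has absolute value at most \<open>mu W\<close>. It remains
  to see that a vector orthogonal to the ones vector has no coordinate \<open>0\<close>. The ones vector
  is fixed by \<open>W\<close>, while the eigenvalues with index \<open>k \<ge> 1\<close> are less than
  \<open>1\<close>; so it only has a coordinate \<open>0\<close>, and this coordinate is nonzero.\<close>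

lemma contraction_orthogonal_to_ones:
  fixes W :: "real mat" and y :: "real vec"
  assumes W: "W \<in> carrier_mat n n" and sym: "transpose_mat W = W"
    and stoch: "W *\<^sub>v vec n (\<lambda>_. 1) = vec n (\<lambda>_. 1)" and mu: "mu W < 1"
    and y: "y \<in> carrier_vec n" and y1: "y \<bullet> vec n (\<lambda>_. 1) = 0"
  shows "(W *\<^sub>v y) \<bullet> (W *\<^sub>v y) \<le> (mu W)\<^sup>2 * (y \<bullet> y)"
proof (cases "n = 0")
  case True
  then show ?thesis using W y by (simp add: scalar_prod_def)
next
  case False
  let ?e = "eigs W" and ?o = "vec n (\<lambda>_. 1 :: real)"
  define D where "D = mat n n (\<lambda>(i, j). if i = j then ?e ! i else 0)"
  obtain P where P: "P \<in> carrier_mat n n" and PP: "transpose_mat P * P = 1\<^sub>m n"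
    and PWP: "transpose_mat P * W * P = D"
    using real_symmetric_diagonalization[OF W sym eigs_real_symmetric(1)[OF W sym]]
    unfolding D_def by blast
  let ?Q = "transpose_mat P"
  have Q: "?Q \<in> carrier_mat n n" and D: "D \<in> carrier_mat n n" using P by (auto simp: D_def)
  have PQ: "P * ?Q = 1\<^sub>m n" by (rule mat_mult_left_right_inverse[OF Q P PP])
  have isometry: "(?Q *\<^sub>v a) \<bullet> (?Q *\<^sub>v b) = a \<bullet> b"
    if ab: "a \<in> carrier_vec n" "b \<in> carrier_vec n" for a b
  proof -
    have "(?Q *\<^sub>v a) \<bullet> (?Q *\<^sub>v b) = a \<bullet> (P *\<^sub>v (?Q *\<^sub>v b))"
      using transpose_vec_mult_scalar[OF P, of "?Q *\<^sub>v b" a] Q ab by simp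
    also have "P *\<^sub>v (?Q *\<^sub>v b) = b"
      using assoc_mult_mat_vec[OF P Q ab(2)] PQ ab by simp
    finally show ?thesis .
  qed
  have diag: "?Q *\<^sub>v (W *\<^sub>v a) = D *\<^sub>v (?Q *\<^sub>v a)" if a: "a \<in> carrier_vec n" for a
  proof -
    have "D *\<^sub>v (?Q *\<^sub>v a) = ?Q *\<^sub>v (W *\<^sub>v ((P * ?Q) *\<^sub>v a))"
      unfolding PWP[symmetric] using P Q W a by (simp add: assoc_mult_mat_vec[of _ n n _ n])
    then show ?thesis unfolding PQ using a by simp
  qed
  have D_nth: "(D *\<^sub>v a) $ i = ?e ! i * a $ i" if "a \<in> carrier_vec n" "i < n" for a i
  proof -
    have "(D *\<^sub>v a) $ i = (\<Sum>j<n. (if i = j then ?e ! i else 0) * a $ j)"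
      using that by (simp add: D_def scalar_prod_def lessThan_atLeast0)
    also have "\<dots> = (\<Sum>j<n. if j = i then ?e ! i * a $ j else 0)"
      by (rule sum.cong) auto
    finally show ?thesis using that by simp
  qed
  have o: "?o \<in> carrier_vec n" by simp
  define c where "c = ?Q *\<^sub>v ?o"
  define z where "z = ?Q *\<^sub>v y"
  have c: "c \<in> carrier_vec n" and z: "z \<in> carrier_vec n"
    unfolding c_def z_def using mult_mat_vec_carrier[OF Q] y o by blast+
  \<comment> \<open>Coordinates of the ones vector: \<open>c\<close> is fixed by \<open>D\<close>, whose later diagonal entries differ from \<open>1\<close>.\<close>
  have c0: "c $ k = 0" if k: "1 \<le> k" "k < n" for k
  proof -
    have "c = D *\<^sub>v c" using diag[OF o] stoch unfolding c_def by simp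
    then have "c $ k = ?e ! k * c $ k" using D_nth[OF c k(2)] by simp
    then show ?thesis using abs_eigs_le_mu[OF W sym k] mu by auto
  qed
  have head: "a \<bullet> c = a $ 0 * c $ 0" if "a \<in> carrier_vec n" for a
  proof -
    have "a \<bullet> c = (\<Sum>k\<in>{0..<n}. a $ k * c $ k)" using c by (simp add: scalar_prod_def)
    also have "\<dots> = (\<Sum>k\<in>{0}. a $ k * c $ k)"
      by (rule sum.mono_neutral_right) (use False c0 in auto)
    finally show ?thesis by simp
  qed
  have "c $ 0 * c $ 0 = ?o \<bullet> ?o" using head[OF c] isometry[OF o o] unfolding c_def by simp
  then have "c $ 0 \<noteq> 0" using False by (auto simp: scalar_prod_def)
  moreover have "z $ 0 * c $ 0 = 0"
    using head[OF z] isometry[OF y o] y1 unfolding c_def z_def by simp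
  ultimately have z0: "z $ 0 = 0" by simp
  have "(W *\<^sub>v y) \<bullet> (W *\<^sub>v y) = (D *\<^sub>v z) \<bullet> (D *\<^sub>v z)"
    using isometry[of "W *\<^sub>v y" "W *\<^sub>v y"] diag[OF y] mult_mat_vec_carrier[OF W y]
    unfolding z_def by simp
  also have "\<dots> = (\<Sum>k<n. (?e ! k * z $ k)\<^sup>2)"
    using D_nth[OF z] D by (simp add: scalar_prod_def power2_eq_square lessThan_atLeast0)
  also have "\<dots> \<le> (\<Sum>k<n. (mu W)\<^sup>2 * (z $ k)\<^sup>2)"
  proof (rule sum_mono)
    fix k assume "k \<in> {..<n}"
    then have k: "k < n" by simp
    show "(?e ! k * z $ k)\<^sup>2 \<le> (mu W)\<^sup>2 * (z $ k)\<^sup>2"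
    proof (cases "k = 0")
      case True
      then show ?thesis using z0 by simp
    next
      case False
      then have "\<bar>?e ! k\<bar> \<le> mu W" using abs_eigs_le_mu[OF W sym] k by simp
      then have "(?e ! k)\<^sup>2 \<le> (mu W)\<^sup>2" by (metis abs_ge_zero power2_abs power_mono)
      then show ?thesis by (simp add: power_mult_distrib mult_right_mono)
    qed
  qed
  also have "\<dots> = (mu W)\<^sup>2 * (z \<bullet> z)"
    using z by (simp add: sum_distrib_left scalar_prod_def power2_eq_square lessThan_atLeast0)
  also have "z \<bullet> z = y \<bullet> y" unfolding z_def by (rule isometry[OF y y])
  finally show ?thesis .
qed

section \<open>Averaging over the network\<close>

text \<open>The variance is the mean square minus the square of the mean.\<close>

lemma sum_square_deviation_le:
  fixes a :: "nat \<Rightarrow> real"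
  assumes "n > 0"
  defines "m \<equiv> (\<Sum>i<n. a i) / real n"
  shows "(\<Sum>i<n. (a i - m)\<^sup>2) \<le> (\<Sum>i<n. (a i)\<^sup>2)"
proof -
  have s: "(\<Sum>i<n. a i) = real n * m" using assms by simp
  have "(\<Sum>i<n. (a i - m)\<^sup>2) = (\<Sum>i<n. (a i)\<^sup>2 - 2 * m * a i + m\<^sup>2)"
    by (simp add: power2_diff algebra_simps)
  also have "\<dots> = (\<Sum>i<n. (a i)\<^sup>2) - 2 * m * (\<Sum>i<n. a i) + real n * m\<^sup>2"
    by (simp add: sum.distrib sum_subtractf sum_distrib_left)
  also have "\<dots> = (\<Sum>i<n. (a i)\<^sup>2) - real n * m\<^sup>2"
    unfolding s by (simp add: power2_eq_square)
  finally show ?thesis by simp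
qed

locale consensus_network =
  fixes n :: nat and G :: "nat pair_pre_digraph" and W :: "real mat"
  assumes n_ge_2: "n \<ge> 2"
    and graph: "pair_graph G" and pverts_eq: "pverts G = {..<n}"
    and conn: "Digraph_Component.connected (with_proj G)"
    and adm: "admissible n G W"
begin

sublocale pair_graph G by (rule graph)

lemma W_carrier: "W \<in> carrier_mat n n"
  and W_sym: "transpose_mat W = W"
  and W_ones: "W *\<^sub>v vec n (\<lambda>_. 1) = vec n (\<lambda>_. 1)"
  and mu_less_1: "mu W < 1"
  using adm unfolding admissible_def by auto

lemma mu_nonneg: "0 \<le> mu W"
  using abs_eigs_le_mu[OF W_carrier W_sym, of 1] n_ge_2 by auto

text \<open>The weights vanish off the diagonal and the edges, so an averaging step is a multiplication
  by \<open>W\<close>.\<close>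

lemma consensus_val_Suc:
  assumes i: "i < n"
  shows "consensus_val f G W Sb (Suc t) i u
    = (\<Sum>j<n. W $$ (i, j) * consensus_val f G W Sb t j u)"
proof -
  have nb: "nbrs G i \<subseteq> {..<n}" "i \<notin> nbrs G i"
    using no_loops' by (auto simp: nbrs_def pverts_eq)
  have fin: "finite (nbrs G i)" using nb finite_subset by blast
  have "consensus_val f G W Sb (Suc t) i u
    = (\<Sum>j\<in>insert i (nbrs G i). W $$ (i, j) * consensus_val f G W Sb t j u)"
    using nb fin by simp
  also have "\<dots> = (\<Sum>j<n. W $$ (i, j) * consensus_val f G W Sb t j u)"
    using nb i adm by (intro sum.mono_neutral_left) (auto simp: nbrs_def pverts_eq admissible_def)
  finally show ?thesis .
qed

text \<open>The vector \<open>y\<close> of deviations from the initial mean \<open>m\<close> evolves by \<open>W\<close>,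
  since the rows of \<open>W\<close> sum to \<open>1\<close>, and stays orthogonal to the ones vector, since
  \<open>W\<close> is symmetric. So its norm shrinks by \<open>mu W\<close> in each step, starting from at most
  \<open>sqrt n * F\<close>, and bounds each of its entries.\<close>

lemma consensus_error:
  assumes a: "\<And>i. i < n \<Longrightarrow> 0 \<le> consensus_val f G W Sb 0 i u \<and> consensus_val f G W Sb 0 i u \<le> F"
    and i: "i < n"
  defines "m \<equiv> (\<Sum>i<n. consensus_val f G W Sb 0 i u) / real n"
  shows "\<bar>consensus_val f G W Sb t i u - m\<bar> \<le> sqrt (real n) * mu W ^ t * F"
proof -
  let ?c = "\<lambda>t i. consensus_val f G W Sb t i u" and ?o = "vec n (\<lambda>_. 1 :: real)"
  define y where "y t = vec n (\<lambda>i. ?c t i - m)" for t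
  have y: "y t \<in> carrier_vec n" for t unfolding y_def by simp
  have n0: "n > 0" using n_ge_2 by simp
  have rows: "(\<Sum>j<n. W $$ (i, j)) = 1" if "i < n" for i
    using arg_cong[OF W_ones, of "\<lambda>x. x $ i"] that W_carrier
    by (simp add: scalar_prod_def lessThan_atLeast0)
  have step: "y (Suc t) = W *\<^sub>v y t" for t
  proof (rule eq_vecI)
    fix i assume "i < dim_vec (W *\<^sub>v y t)"
    then have i: "i < n" using W_carrier by simp
    have "(W *\<^sub>v y t) $ i = (\<Sum>j<n. W $$ (i, j) * (?c t j - m))"
      using i W_carrier by (simp add: y_def scalar_prod_def lessThan_atLeast0)
    also have "\<dots> = (\<Sum>j<n. W $$ (i, j) * ?c t j) - (\<Sum>j<n. W $$ (i, j)) * m"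
      by (simp add: right_diff_distrib sum_subtractf sum_distrib_right)
    also have "\<dots> = y (Suc t) $ i"
      unfolding rows[OF i] y_def
      using i by (simp add: consensus_val_Suc[OF i] del: consensus_val.simps)
    finally show "y (Suc t) $ i = (W *\<^sub>v y t) $ i" by simp
  qed (use W_carrier in \<open>simp add: y_def\<close>)
  have orth: "y t \<bullet> ?o = 0" for t
  proof (induction t)
    case 0
    have "y 0 \<bullet> ?o = (\<Sum>i<n. ?c 0 i) - real n * m"
      by (simp add: y_def scalar_prod_def lessThan_atLeast0 sum_subtractf)
    then show ?case unfolding m_def using n0 by simp
  next
    case (Suc t)
    have "y (Suc t) \<bullet> ?o = y t \<bullet> (W *\<^sub>v ?o)"
      unfolding step using transpose_vec_mult_scalar[OF W_carrier, of ?o "y t"] y W_sym by simp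
    then show ?case using Suc W_ones by simp
  qed
  have decay: "y t \<bullet> y t \<le> (mu W ^ t)\<^sup>2 * (y 0 \<bullet> y 0)" for t
  proof (induction t)
    case (Suc t)
    have "y (Suc t) \<bullet> y (Suc t) \<le> (mu W)\<^sup>2 * (y t \<bullet> y t)"
      unfolding step
      by (rule contraction_orthogonal_to_ones[OF W_carrier W_sym W_ones mu_less_1 y orth])
    also have "\<dots> \<le> (mu W)\<^sup>2 * ((mu W ^ t)\<^sup>2 * (y 0 \<bullet> y 0))"
      by (rule mult_left_mono[OF Suc]) simp
    finally show ?case by (simp add: power_mult_distrib algebra_simps)
  qed simp
  have sq: "y t \<bullet> y t = (\<Sum>i<n. (?c t i - m)\<^sup>2)" for t
    by (simp add: y_def scalar_prod_def lessThan_atLeast0 power2_eq_square)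
  have "(\<Sum>i<n. (?c 0 i - m)\<^sup>2) \<le> (\<Sum>i<n. (?c 0 i)\<^sup>2)"
    unfolding m_def by (rule sum_square_deviation_le[OF n0])
  also have "\<dots> \<le> (\<Sum>i<n. F\<^sup>2)"
    using a by (intro sum_mono power_mono) auto
  finally have initial: "(\<Sum>i<n. (?c 0 i - m)\<^sup>2) \<le> real n * F\<^sup>2" by simp
  have "(?c t i - m)\<^sup>2 \<le> y t \<bullet> y t"
    unfolding sq using i by (intro member_le_sum) auto
  also have "\<dots> \<le> (mu W ^ t)\<^sup>2 * (y 0 \<bullet> y 0)" by (rule decay)
  also have "\<dots> \<le> (mu W ^ t)\<^sup>2 * (real n * F\<^sup>2)"
    unfolding sq by (rule mult_left_mono[OF initial]) simp
  also have "\<dots> = (sqrt (real n) * mu W ^ t * F)\<^sup>2"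
    by (simp add: power_mult_distrib)
  finally have "(?c t i - m)\<^sup>2 \<le> (sqrt (real n) * mu W ^ t * F)\<^sup>2" .
  then have "\<bar>?c t i - m\<bar> \<le> \<bar>sqrt (real n) * mu W ^ t * F\<bar>"
    unfolding abs_le_square_iff .
  moreover have "0 \<le> F" using order_trans[of 0 "?c 0 0" F] a[OF n0] by blast
  then have "0 \<le> sqrt (real n) * mu W ^ t * F" using mu_nonneg by simp
  ultimately show ?thesis by (metis abs_of_nonneg)
qed

section \<open>Exchange of candidate sets\<close>

text \<open>Along a walk each exchange passes the candidate set of the end point one vertex further back.\<close>

lemma candidates_subset_walk:
  assumes "awalk i p j"
  shows "candidates G C (length p) i \<subseteq> C j"
  using assms
proof (induction p arbitrary: i)
  case Nil
  then show ?case by (simp add: awalk_Nil_iff)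
next
  case (Cons e p)
  then have "snd e \<in> nbrs G i" and "awalk (snd e) p j"
    by (auto simp: awalk_Cons_iff nbrs_def)
  then show ?case using Cons.IH by fastforce
qed

lemma candidates_antimono:
  assumes "s \<le> t"
  shows "candidates G C t i \<subseteq> candidates G C s i"
  using assms by (induction rule: dec_induct) auto

lemma walk_within_diam:
  assumes ij: "i < n" "j < n"
  shows "\<exists>p. awalk i p j \<and> length p \<le> diam G"
proof -
  have "strongly_connected (with_proj G)"
    using symmetric_connected_imp_strongly_connected[OF sym_arcs conn] .
  then have "\<exists>p. apath i p j"
    using ij reachable_apath by (auto simp: strongly_connected_def pverts_eq)
  then have "\<exists>l p. apath i p j \<and> length p = l" by blast
  from LeastI_ex[OF this] obtain p where p: "apath i p j" "length p = path_dist G i j"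
    unfolding path_dist_def by blast
  let ?D = "{path_dist G i j | i j. i \<in> pverts G \<and> j \<in> pverts G}"
  have "?D = (\<lambda>(i, j). path_dist G i j) ` ({..<n} \<times> {..<n})"
    by (auto simp: pverts_eq)
  then have "finite ?D" by simp
  then have "path_dist G i j \<le> diam G"
    unfolding diam_def using ij by (intro Max_ge) (auto simp: pverts_eq)
  then show ?thesis using p(2) awalkI_apath[OF p(1)] by (intro exI[of _ p]) simp
qed

text \<open>Each agent is reached by a walk from each other agent within the diameter, hence knows all
  restrictions; and an exchange never removes an element common to all sets.\<close>

lemma candidates_diam:
  assumes "i < n"
  shows "candidates G C (diam G) i = (\<Inter>j<n. C j)"
proof
  show "candidates G C (diam G) i \<subseteq> (\<Inter>j<n. C j)"
  proof (rule INT_greatest)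
    fix j assume "j \<in> {..<n}"
    then obtain p where "awalk i p j" "length p \<le> diam G"
      using walk_within_diam assms by blast
    then show "candidates G C (diam G) i \<subseteq> C j"
      using candidates_antimono[of "length p" "diam G" C i] candidates_subset_walk[of i p j C]
      by (rule_tac order_trans)
  qed
  have "(\<Inter>j<n. C j) \<subseteq> candidates G C s i" if "i < n" for s i
    using that
  proof (induction s arbitrary: i)
    case (Suc s)
    then show ?case by (auto simp: nbrs_def pverts_eq)
  qed auto
  then show "(\<Inter>j<n. C j) \<subseteq> candidates G C (diam G) i" using assms .
qed

end

lemma min_label_in:
  assumes v: "bij_betw v {1..card V} V" and X: "X \<subseteq> V" "X \<noteq> {}"
  shows "v (min_label V v X) \<in> X"
proof -
  let ?J = "{j \<in> {1..card V}. v j \<in> X}"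
  obtain x where x: "x \<in> X" "x \<in> v ` {1..card V}"
    using X bij_betw_imp_surj_on[OF v] by auto
  then have "?J \<noteq> {}" by auto
  then have "Min ?J \<in> ?J" by (intro Min_in) auto
  then show ?thesis unfolding min_label_def by simp
qed

section \<open>One round of the algorithm\<close>

context consensus_network
begin

text \<open>Here \<open>m w\<close> is the true marginal gain and \<open>?x i w\<close> the estimate of agent \<open>i\<close>,
  which is off by at most \<open>\<epsilon>\<close>. A maximizer \<open>b\<close> of \<open>m\<close> has an estimate within
  \<open>2\<epsilon> \<le> \<psi>\<close> of the largest estimate, so it lies in the common intersection \<open>X\<close>
  and \<open>X\<close> is nonempty. The chosen \<open>u \<in> X\<close> passes the test of agent \<open>0\<close>;
  comparing estimates with true gains costs \<open>\<epsilon>\<close> for \<open>u\<close> and \<open>\<epsilon>\<close> for the competitor.\<close>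

lemma distributed_round:
  fixes f :: "nat \<Rightarrow> 'a set \<Rightarrow> real" and F \<psi> :: real
  assumes fin: "finite V" and v: "bij_betw v {1..card V} V"
    and mono: "\<And>i. i < n \<Longrightarrow> monotone_setfun V (f i)"
    and nonneg: "\<And>i A. i < n \<Longrightarrow> A \<subseteq> V \<Longrightarrow> 0 \<le> f i A"
    and F: "\<And>i. i < n \<Longrightarrow> f i V \<le> F"
    and S: "S \<subset> V" and Sb: "\<And>i. i < n \<Longrightarrow> Sb i = S"
    and \<psi>: "2 * (sqrt (real n) * mu W ^ T * F) \<le> \<psi>"
  defines "g \<equiv> \<lambda>A. (1 / real n) * (\<Sum>i<n. f i A)"
  defines "\<epsilon> \<equiv> sqrt (real n) * mu W ^ T * F"
  shows "\<exists>u\<in>V - S.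
    (\<forall>i<n. v (min_label V v (final_candidates V f G W T (T + 1 + diam G) \<psi> Sb i)) = u) \<and>
    (\<forall>w\<in>V - S. g (insert w S) - g S \<le> g (insert u S) - g S + (\<psi> + 2 * \<epsilon>))"
proof -
  let ?x = "consensus_val f G W Sb T"
  let ?C = "initial_candidates V f G W T \<psi> Sb"
  define m where "m w = g (insert w S) - g S" for w
  have n0: "n > 0" using n_ge_2 by simp
  have VS: "finite (V - S)" "V - S \<noteq> {}" using fin S by auto
  have err: "\<bar>?x i w - m w\<bar> \<le> \<epsilon>" if i: "i < n" and w: "w \<in> V - S" for i w
  proof -
    \<comment> \<open>A marginal gain is at most \<open>f j V \<le> F\<close> because \<open>f j S\<close> is nonnegative.\<close>
    have "0 \<le> consensus_val f G W Sb 0 j w \<and> consensus_val f G W Sb 0 j w \<le> F"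
      if j: "j < n" for j
    proof -
      have "f j S \<le> f j (insert w S)" "f j (insert w S) \<le> f j V"
        using mono[OF j] S w unfolding monotone_setfun_def
        by (meson DiffD1 insert_subset order_refl psubset_imp_subset subset_insertI)+
      moreover have "0 \<le> f j S" using nonneg[OF j] S by auto
      ultimately show ?thesis using F[OF j] Sb[OF j] by simp
    qed
    from consensus_error[of f Sb w F, OF this i]
    have "\<bar>?x i w - (\<Sum>i<n. consensus_val f G W Sb 0 i w) / real n\<bar> \<le> \<epsilon>"
      unfolding \<epsilon>_def by blast
    moreover have "(\<Sum>i<n. consensus_val f G W Sb 0 i w) / real n = m w"
      using Sb by (simp add: m_def g_def sum_subtractf diff_divide_distrib)
    ultimately show ?thesis by simp
  qed
  have C_iff: "w \<in> ?C i \<longleftrightarrow> w \<in> V - S \<and> (\<forall>z\<in>V - S. ?x i z - \<psi> \<le> ?x i w)" if i: "i < n" for i w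
  proof -
    have "Max (?x i ` (V - S)) \<le> ?x i w + \<psi> \<longleftrightarrow> (\<forall>z\<in>V - S. ?x i z \<le> ?x i w + \<psi>)"
      using VS by simp
    then show ?thesis using Sb[OF i] by (auto simp: initial_candidates_def algebra_simps)
  qed
  define X where "X = (\<Inter>j<n. ?C j)"
  have final: "final_candidates V f G W T (T + 1 + diam G) \<psi> Sb i = X" if "i < n" for i
    unfolding final_candidates_def X_def using candidates_diam[OF that] by simp
  obtain b where b: "b \<in> V - S" and best: "\<And>w. w \<in> V - S \<Longrightarrow> m w \<le> m b"
    using obtains_MAX[OF VS, of m] VS by (metis Max_ge finite_imageI imageI)
  have bX: "b \<in> X"
    unfolding X_def
  proof (intro INT_I)
    fix i assume "i \<in> {..<n}"
    then have i: "i < n" by simp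
    have "?x i z - \<psi> \<le> ?x i b" if z: "z \<in> V - S" for z
      using err[OF i z] err[OF i b] best[OF z] \<psi> unfolding \<epsilon>_def by linarith
    then show "b \<in> ?C i" using C_iff[OF i] b by blast
  qed
  have XV: "X \<subseteq> V - S" unfolding X_def using C_iff[OF n0] n0 by blast
  define u where "u = v (min_label V v X)"
  have uX: "u \<in> X" unfolding u_def using bX XV by (intro min_label_in[OF v]) auto
  have u: "u \<in> V - S" using uX XV by blast
  have "m w \<le> m u + (\<psi> + 2 * \<epsilon>)" if w: "w \<in> V - S" for w
  proof -
    have "u \<in> ?C 0" using uX n0 unfolding X_def by blast
    then have "?x 0 w - \<psi> \<le> ?x 0 u" using C_iff[OF n0] w by blast
    then show ?thesis using err[OF n0 w] err[OF n0 u] by linarith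
  qed
  then show ?thesis
    using u final unfolding m_def by (intro bexI[of _ u] conjI) (simp_all add: u_def)
qed

end

section \<open>Greedy maximization with inexact steps\<close>

lemma submodular_sum_marginals:
  assumes sub: "submodular V g" and S: "S \<subseteq> V" and R: "finite R" "R \<subseteq> V - S"
  shows "g (S \<union> R) - g S \<le> (\<Sum>u\<in>R. g (insert u S) - g S)"
  using R
proof (induction R rule: finite_induct)
  case (insert u R)
  have "g ({u} \<union> (S \<union> R)) - g (S \<union> R) \<le> g ({u} \<union> S) - g S"
    using sub S insert.prems insert.hyps unfolding submodular_def
    by (metis (no_types, lifting) Diff_iff Diff_subset Un_iff Un_least insert_subset order_trans sup_ge1)
  then show ?case using insert by simp
qed simp

text \<open>Adding the missing elements of \<open>R\<close> one by one gains at most \<open>d\<close> each, by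
  submodularity. When \<open>R \<subseteq> S\<close> nothing is added; \<open>d \<ge> 0\<close> covers this and all
  cases with fewer than \<open>K\<close> missing elements.\<close>

lemma optimum_gap_le:
  assumes fin: "finite V" and mono: "monotone_setfun V g" and sub: "submodular V g"
    and S: "S \<subseteq> V" and R: "R \<subseteq> V" "card R \<le> K" and d: "d \<ge> 0"
    and marg: "\<And>w. w \<in> V - S \<Longrightarrow> g (insert w S) - g S \<le> d"
  shows "g R - g S \<le> real K * d"
proof -
  have finR: "finite (R - S)" using fin R by (meson finite_Diff finite_subset)
  have "g R \<le> g (S \<union> (R - S))"
    using mono S R unfolding monotone_setfun_def by (metis Un_Diff_cancel Un_least sup_ge2)
  also have "\<dots> - g S \<le> (\<Sum>u\<in>R - S. g (insert u S) - g S)"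
    using R by (intro submodular_sum_marginals[OF sub S finR]) auto
  also have "\<dots> \<le> (\<Sum>u\<in>R - S. d)"
    using R marg by (intro sum_mono) auto
  also have "\<dots> \<le> real K * d"
    using R d fin card_mono[of R "R - S"] finite_subset[of R V]
    by (auto intro!: mult_right_mono)
  finally show ?thesis by simp
qed

lemma one_minus_inverse_power_le:
  assumes "K \<ge> 1"
  shows "(1 - 1 / real K) ^ K \<le> 1 / exp 1"
proof -
  have "(1 - 1 / real K) ^ K \<le> exp (- 1 / real K) ^ K"
    using assms exp_ge_add_one_self[of "- 1 / real K"] by (intro power_mono) auto
  also have "\<dots> = exp (-1)"
    using assms by (simp add: exp_of_nat_mult[symmetric])
  finally show ?thesis by (simp add: exp_minus inverse_eq_divide)
qed

text \<open>By \<open>optimum_gap_le\<close> with the bound \<open>d\<close> on marginal gains taken to be the achieved gain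
  plus \<open>\<delta>\<close>, each step closes at least the fraction \<open>1 / K\<close> of the gap to
  \<open>g R\<close>, up to \<open>\<delta>\<close>. The errors \<open>\<delta>\<close> of the steps are not amplified because the
  factor \<open>1 - 1 / K\<close> is at most \<open>1\<close>.\<close>

lemma approximate_greedy:
  assumes fin: "finite V" and mono: "monotone_setfun V g" and sub: "submodular V g"
    and empty: "g {} = 0" and K: "K \<ge> 1"
    and R: "R \<subseteq> V" "card R \<le> K" and \<delta>: "\<delta> \<ge> 0"
    and S0: "S 0 = {}" and SV: "\<And>k. k \<le> K \<Longrightarrow> S k \<subseteq> V"
    and inc: "\<And>k. k < K \<Longrightarrow> S k \<subseteq> S (Suc k)"
    and step: "\<And>k w. k < K \<Longrightarrow> w \<in> V - S k \<Longrightarrow>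
      g (insert w (S k)) - g (S k) \<le> g (S (Suc k)) - g (S k) + \<delta>"
  shows "g (S K) \<ge> (1 - 1 / exp 1) * g R - real K * \<delta>"
proof -
  let ?q = "1 - 1 / real K"
  have q: "0 \<le> ?q" "?q \<le> 1" using K by auto
  have "g R - g (S k) \<le> ?q ^ k * g R + real k * \<delta>" if "k \<le> K" for k
    using that
  proof (induction k)
    case 0
    then show ?case using S0 empty by simp
  next
    case (Suc k)
    have "g (S k) \<le> g (S (Suc k))"
      using mono inc[of k] SV[of "Suc k"] Suc.prems unfolding monotone_setfun_def by auto
    then have "g R - g (S k) \<le> real K * (g (S (Suc k)) - g (S k) + \<delta>)"
      using Suc.prems SV[of k] step \<delta> by (intro optimum_gap_le[OF fin mono sub _ R]) auto
    then have "(g R - g (S k)) / real K \<le> g (S (Suc k)) - g (S k) + \<delta>"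
      using K by (simp add: field_simps)
    then have "g R - g (S (Suc k)) \<le> ?q * (g R - g (S k)) + \<delta>"
      by (simp add: algebra_simps diff_divide_distrib)
    also have "\<dots> \<le> ?q * (?q ^ k * g R + real k * \<delta>) + \<delta>"
      using Suc q by (intro add_right_mono mult_left_mono) auto
    also have "\<dots> \<le> ?q ^ Suc k * g R + real (Suc k) * \<delta>"
      using mult_right_mono[OF q(2), of "real k * \<delta>"] \<delta> by (simp add: algebra_simps)
    finally show ?case .
  qed
  from this[of K] have "g R - g (S K) \<le> ?q ^ K * g R + real K * \<delta>" by simp
  moreover have "g R \<ge> 0" using mono R empty unfolding monotone_setfun_def by (metis empty_subsetI)
  ultimately show ?thesis
    using mult_right_mono[OF one_minus_inverse_power_le[OF K], of "g R"] by (simp add: algebra_simps)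
qed

section \<open>The approximation guarantee\<close>

lemma monotone_setfun_mean:
  assumes "\<And>i. i < n \<Longrightarrow> monotone_setfun V (f i)"
  shows "monotone_setfun V (\<lambda>A. (1 / real n) * (\<Sum>i<n. f i A))"
  using assms unfolding monotone_setfun_def by (auto intro!: divide_right_mono sum_mono)

lemma submodular_mean:
  assumes "\<And>i. i < n \<Longrightarrow> submodular V (f i)"
  shows "submodular V (\<lambda>A. (1 / real n) * (\<Sum>i<n. f i A))"
  unfolding submodular_def
proof (intro allI ballI impI)
  fix A B u assume "u \<in> V - B" "A \<subseteq> B \<and> B \<subseteq> V"
  then have "(\<Sum>i<n. f i ({u} \<union> B) - f i B) \<le> (\<Sum>i<n. f i ({u} \<union> A) - f i A)"
    using assms unfolding submodular_def by (intro sum_mono) blast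
  then have "(1 / real n) * (\<Sum>i<n. f i ({u} \<union> B) - f i B)
      \<le> (1 / real n) * (\<Sum>i<n. f i ({u} \<union> A) - f i A)"
    by (rule mult_left_mono) simp
  then show "(1 / real n) * (\<Sum>i<n. f i ({u} \<union> B)) - (1 / real n) * (\<Sum>i<n. f i B)
      \<le> (1 / real n) * (\<Sum>i<n. f i ({u} \<union> A)) - (1 / real n) * (\<Sum>i<n. f i A)"
    by (simp add: sum_subtractf right_diff_distrib)
qed

theorem theorem1:
  fixes V :: "'a set" and v :: "nat \<Rightarrow> 'a"
    and n K T T' :: nat
    and f :: "nat \<Rightarrow> 'a set \<Rightarrow> real" and favg :: "'a set \<Rightarrow> real"
    and G :: "nat pair_pre_digraph" and W :: "real mat"
    and F\<^sub>h \<epsilon> \<psi> :: real and Sopt :: "'a set"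
  assumes "finite V" and "bij_betw v {1..card V} V"
    and "n \<ge> 2"
    and "\<And>i A. i < n \<Longrightarrow> A \<subseteq> V \<Longrightarrow> f i A \<ge> 0"
    and "\<And>i. i < n \<Longrightarrow> monotone_setfun V (f i)"
    and "\<And>i. i < n \<Longrightarrow> submodular V (f i)"
    and "\<And>i. i < n \<Longrightarrow> f i {} = 0"
    and "favg = (\<lambda>S. (1 / real n) * (\<Sum>i<n. f i S))"
    and "1 \<le> K" and "K \<le> card V"
    and "pair_graph G" and "pverts G = {..<n}"
    and "Digraph_Component.connected (with_proj G)"
    and "admissible n G W"
    and "T \<ge> 1" and "T' = T + 1 + diam G"
    and "F\<^sub>h = Max ((\<lambda>i. f i V) ` {..<n})"
    and "\<epsilon> = sqrt (real n) * mu W ^ T * F\<^sub>h"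
    and "\<psi> \<ge> 0" and "\<psi> \<ge> 4 * sqrt (real n) * mu W ^ T * F\<^sub>h"
    and "is_arg_max favg (\<lambda>S. S \<subseteq> V \<and> card S \<le> K) Sopt"
  shows "\<exists>S. (\<forall>i<n. dist_greedy V v f G W T T' \<psi> K i = S) \<and>
             S \<subseteq> V \<and> card S \<le> K \<and>
             favg S \<ge> (1 - 1 / exp 1) * favg Sopt - real K * (\<psi> + 2 * \<epsilon>)"
proof -
  interpret consensus_network n G W
    using assms(3,11-14) by (rule consensus_network.intro)
  let ?S = "\<lambda>k. dist_greedy V v f G W T T' \<psi> k"
  let ?\<delta> = "\<psi> + 2 * \<epsilon>"
  have n0: "0 < n" using assms(3) by simp
  have F: "f i V \<le> F\<^sub>h" if "i < n" for i
    unfolding assms(17) using that by (intro Max_ge) auto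
  have "0 \<le> F\<^sub>h" using assms(4)[OF n0, of V] F[OF n0] by simp
  then have \<epsilon>: "0 \<le> \<epsilon>" unfolding assms(18) using mu_nonneg by simp
  have \<psi>: "2 * (sqrt (real n) * mu W ^ T * F\<^sub>h) \<le> \<psi>"
    using assms(20) \<epsilon> unfolding assms(18) by simp
  have round: "\<exists>u\<in>V - A. (\<forall>i<n. ?S (Suc k) i = insert u A) \<and>
      (\<forall>w\<in>V - A. favg (insert w A) - favg A \<le> favg (insert u A) - favg A + ?\<delta>)"
    if AV: "A \<subset> V" and A: "\<forall>i<n. ?S k i = A" for k A
  proof -
    have held: "\<And>i. i < n \<Longrightarrow> ?S k i = A" using A by blast
    obtain u where u: "u \<in> V - A"
      and same: "\<forall>i<n. v (min_label V v (final_candidates V f G W T T' \<psi> (?S k) i)) = u"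
      and near: "\<forall>w\<in>V - A. favg (insert w A) - favg A \<le> favg (insert u A) - favg A + ?\<delta>"
      using distributed_round[of V v f F\<^sub>h A "?S k" T \<psi>, OF assms(1,2,5,4) F AV held \<psi>]
      unfolding assms(8,16,18) by blast
    then show ?thesis using A by (intro bexI[of _ u]) auto
  qed
  \<comment> \<open>Tracking the exact size keeps \<open>V - A\<close> nonempty up to round \<open>K\<close>.\<close>
  have consensus: "\<exists>A. (\<forall>i<n. ?S k i = A) \<and> A \<subseteq> V \<and> card A = k" if "k \<le> K" for k
    using that
  proof (induction k)
    case (Suc k)
    then obtain A where A: "\<forall>i<n. ?S k i = A" "A \<subseteq> V" "card A = k" by auto
    then have "A \<subset> V" using Suc.prems assms(10) by auto
    from round[OF this A(1)] obtain u where "u \<in> V - A" "\<forall>i<n. ?S (Suc k) i = insert u A"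
      by blast
    then show ?case
      using A finite_subset[OF A(2) assms(1)] by (intro exI[of _ "insert u A"]) auto
  qed auto
  have agree: "?S k i = ?S k 0" if "i < n" "k \<le> K" for i k
    using consensus[OF that(2)] that(1) n0 by auto
  have SV: "?S k 0 \<subseteq> V" and card_S: "card (?S k 0) = k" if "k \<le> K" for k
    using consensus[OF that] n0 by auto
  have step: "favg (insert w (?S k 0)) - favg (?S k 0) \<le> favg (?S (Suc k) 0) - favg (?S k 0) + ?\<delta>"
    if k: "k < K" and w: "w \<in> V - ?S k 0" for k w
  proof -
    have "?S k 0 \<subset> V" using SV[of k] w k by auto
    moreover have "\<forall>i<n. ?S k i = ?S k 0" using agree less_imp_le[OF k] by blast
    ultimately obtain u where "\<forall>i<n. ?S (Suc k) i = insert u (?S k 0)"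
      and "\<forall>w\<in>V - ?S k 0. favg (insert w (?S k 0)) - favg (?S k 0)
        \<le> favg (insert u (?S k 0)) - favg (?S k 0) + ?\<delta>"
      using round[of "?S k 0" k] by blast
    then show ?thesis using n0 w by auto
  qed
  have "favg (?S K 0) \<ge> (1 - 1 / exp 1) * favg Sopt - real K * ?\<delta>"
  proof (rule approximate_greedy[where V = V and S = "\<lambda>k. ?S k 0", OF assms(1)])
    show "monotone_setfun V favg" "submodular V favg"
      unfolding assms(8) using monotone_setfun_mean submodular_mean assms(5,6) by blast+
    show "favg {} = 0" unfolding assms(8) using assms(7) by simp
    show "Sopt \<subseteq> V" "card Sopt \<le> K" using assms(21) by (auto simp: is_arg_max_def)
    show "0 \<le> ?\<delta>" using assms(19) \<epsilon> by simp
  qed (use assms(9) SV step in auto)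
  moreover have "\<forall>i<n. ?S K i = ?S K 0" using agree by blast
  moreover have "?S K 0 \<subseteq> V" "card (?S K 0) \<le> K" using SV[of K] card_S[of K] by simp_all
  ultimately show ?thesis by blast
qed

end
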